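(* Let $G=(V,E)$ be a simple undirected graph, let $S\subseteq\binom{V}{2}$ be a set of terminal pairs, and let $a^{\mathsf T}x\geq b$ be a facet-defining inequality for $\mathrm{MultC}(G,S)$ such that $\{x: a^{\mathsf T}x\geq b\}\neq\{x: x_{e'}\geq 0\}$ for all $e'\in E$. Then every edge $e\in E(\mathrm{supp}(a))$ lies on an $s$-$t$-path in $\mathrm{supp}(a)$ for some $\{s,t\}\in S$. In particular, every leaf of $\mathrm{supp}(a)$ is a terminal.
   Context: Given a graph $G=(V,E)$ and $S\subseteq\binom{V}{2}$, an ($S$-)multicut is a set $\delta\subseteq E$ such that for every $\{s,t\}\in S$ the nodes $s$ and $t$ lie in different components of $G-\delta$. A node $v$ is a terminal if $\{v,w\}\in S$ for some $w$. For $F\subseteq E$, $x^F\in\mathbb{R}^E$ is its incidence vector. The multicut polytope is $\mathrm{MultC}^{\square}(G,S)=\mathrm{conv}\{x^\delta:\delta \text{ an } S\text{-multicut}\}$ and the multicut dominant is $\mathrm{MultC}(G,S)=\mathrm{MultC}^{\square}(G,S)+\mathbb{R}^E_{\geq 0}$. For a valid inequality $a^{\mathsf T}x\geq b$, its support graph $\mathrm{supp}(a)$ is the subgraph of $G$ induced by the edge set $\{e\in E: a_e\neq 0\}$ (i.e., these edges together with their endpoints). *)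

theory Defs
  imports "HOL-Analysis.Analysis" "HOL-Library.Ramsey" "HOL-Library.Set_Algebras"
begin

definition simple_graph :: "'v set \<Rightarrow> 'v set set \<Rightarrow> bool" where
  "simple_graph V E \<longleftrightarrow> finite V \<and> E \<subseteq> nsets V 2"

definition component_of_node :: "'v set \<Rightarrow> 'v set set \<Rightarrow> 'v \<Rightarrow> 'v set" where
  "component_of_node V E v = {w \<in> V. (v, w) \<in> {(x, y). {x, y} \<in> E}\<^sup>*}"

definition multicut :: "'v set \<Rightarrow> 'v set set \<Rightarrow> 'v set set \<Rightarrow> 'v set set \<Rightarrow> bool" where
  "multicut V E S \<delta> \<longleftrightarrow> \<delta> \<subseteq> E \<and>
     (\<forall>s t. {s, t} \<in> S \<longrightarrow>
        component_of_node V (E - \<delta>) s \<noteq> component_of_node V (E - \<delta>) t)"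

definition terminal :: "'v set set \<Rightarrow> 'v \<Rightarrow> bool" where
  "terminal S v \<longleftrightarrow> (\<exists>w. {v, w} \<in> S)"

text \<open>The edge set is a variable, not a type, so the space of real vectors indexed by E is
  represented as the coordinate subspace of vectors that vanish outside E. Dimensions of its
  subsets, and hence facets, do not depend on the ambient space.\<close>

definition edge_space :: "'v set set \<Rightarrow> (real ^ ('v::finite set)) set" where
  "edge_space E = {x. \<forall>e. e \<notin> E \<longrightarrow> x $ e = 0}"

definition incidence_vector :: "'v set set \<Rightarrow> real ^ ('v::finite set)" where
  "incidence_vector F = (\<chi> e. if e \<in> F then 1 else 0)"

definition multicut_polytope ::
    "'v set \<Rightarrow> 'v set set \<Rightarrow> 'v set set \<Rightarrow> (real ^ ('v::finite set)) set" where
  "multicut_polytope V E S = convex hull {incidence_vector \<delta> | \<delta>. multicut V E S \<delta>}"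

definition multicut_dominant ::
    "'v set \<Rightarrow> 'v set set \<Rightarrow> 'v set set \<Rightarrow> (real ^ ('v::finite set)) set" where
  "multicut_dominant V E S =
     multicut_polytope V E S + {x \<in> edge_space E. \<forall>e\<in>E. 0 \<le> x $ e}"

definition facet_defining :: "'a::euclidean_space set \<Rightarrow> 'a \<Rightarrow> real \<Rightarrow> bool" where
  "facet_defining P a b \<longleftrightarrow>
     (\<forall>x\<in>P. b \<le> a \<bullet> x) \<and> (P \<inter> {x. a \<bullet> x = b}) facet_of P"

definition supp_edges :: "'v set set \<Rightarrow> real ^ ('v::finite set) \<Rightarrow> 'v set set" where
  "supp_edges E a = {e \<in> E. a $ e \<noteq> 0}"

definition supp_nodes :: "'v set set \<Rightarrow> real ^ ('v::finite set) \<Rightarrow> 'v set" where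
  "supp_nodes E a = \<Union> (supp_edges E a)"

definition is_path :: "'v set \<Rightarrow> 'v set set \<Rightarrow> 'v \<Rightarrow> 'v \<Rightarrow> 'v list \<Rightarrow> bool" where
  "is_path V E s t p \<longleftrightarrow> p \<noteq> [] \<and> set p \<subseteq> V \<and> distinct p \<and>
     hd p = s \<and> last p = t \<and> successively (\<lambda>x y. {x, y} \<in> E) p"

definition path_edges :: "'v list \<Rightarrow> 'v set set" where
  "path_edges p = {{p ! i, p ! Suc i} | i. Suc i < length p}"

definition leaf :: "'v set \<Rightarrow> 'v set set \<Rightarrow> 'v \<Rightarrow> bool" where
  "leaf V E v \<longleftrightarrow> v \<in> V \<and> card {e \<in> E. v \<in> e} = 1"

end

theory Submission
  imports Defs
begin

text \<open>Suppose that an edge \<open>e\<close> of the support lies on no terminal path of the support. For every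
  multicut \<open>\<delta>\<close>, adding all edges outside the support and removing \<open>e\<close> gives again a multicut, so
  the inequality stays valid when the coefficient of \<open>e\<close> is replaced by 0. Hence the facet lies in
  the hyperplane \<open>x\<^sub>e = 0\<close>, and by dimension the inequality is a multiple of \<open>x\<^sub>e \<ge> 0\<close>.\<close>

section \<open>Walks, paths and components\<close>

text \<open>The path grows at its front. If the new node already occurs on it, the suffix starting
  at that node is taken instead, which keeps the nodes distinct.\<close>

lemma rtrancl_imp_distinct_path:
  assumes "(s, t) \<in> R\<^sup>*"
  shows "\<exists>p. p \<noteq> [] \<and> hd p = s \<and> last p = t \<and> distinct p \<and> successively (\<lambda>x y. (x, y) \<in> R) p"
  using assms
proof (induction rule: converse_rtrancl_induct)
  case base
  show ?case by (intro exI[of _ "[t]"]) auto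
next
  case (step x y)
  then obtain p where p: "p \<noteq> []" "hd p = y" "last p = t" "distinct p"
      "successively (\<lambda>x y. (x, y) \<in> R) p"
    by blast
  show ?case
  proof (cases "x \<in> set p")
    case True
    then obtain q r where "p = q @ x # r"
      by (meson split_list)
    with p show ?thesis
      by (intro exI[of _ "x # r"]) (auto simp: successively_append_iff)
  next
    case False
    with p step(1) show ?thesis
      by (intro exI[of _ "x # p"]) (auto simp: successively_Cons)
  qed
qed

lemma successively_imp_rtrancl:
  assumes "p \<noteq> []" "successively (\<lambda>x y. (x, y) \<in> R) p"
  shows "(hd p, last p) \<in> R\<^sup>*"
  using assms
proof (induction p rule: induct_list012)
  case (3 x y zs)
  then show ?case
    by (auto intro: converse_rtrancl_into_rtrancl)
qed auto

lemma component_of_node_eq_iff: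
  assumes "s \<in> V" "t \<in> V"
  shows "component_of_node V E s = component_of_node V E t \<longleftrightarrow> (s, t) \<in> {(x, y). {x, y} \<in> E}\<^sup>*"
    (is "_ \<longleftrightarrow> _ \<in> ?R\<^sup>*")
proof
  assume "component_of_node V E s = component_of_node V E t"
  \<comment> \<open>Components collect nodes of \<open>V\<close> alone, so this uses
    \<open>t\<close> \<in> \<open>V\<close>.\<close>
  moreover have "t \<in> component_of_node V E t"
    using assms by (auto simp: component_of_node_def)
  ultimately have "t \<in> component_of_node V E s"
    by simp
  then show "(s, t) \<in> ?R\<^sup>*"
    by (auto simp: component_of_node_def)
next
  assume st: "(s, t) \<in> ?R\<^sup>*"
  have "sym ?R"
    by (auto simp: sym_def insert_commute)
  then have "(t, s) \<in> ?R\<^sup>*"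
    using st by (meson sym_rtrancl symD)
  with st show "component_of_node V E s = component_of_node V E t"
    unfolding component_of_node_def by (auto intro: rtrancl_trans)
qed

text \<open>Terminals lie in \<open>V\<close>, so components can be traded for reachability, which
  is the form that yields paths.\<close>

lemma multicut_iff:
  assumes "S \<subseteq> nsets V 2"
  shows "multicut V E S \<delta> \<longleftrightarrow>
    \<delta> \<subseteq> E \<and> (\<forall>s t. {s, t} \<in> S \<longrightarrow> (s, t) \<notin> {(x, y). {x, y} \<in> E - \<delta>}\<^sup>*)"
proof -
  have "s \<in> V" "t \<in> V" if "{s, t} \<in> S" for s t
    using that assms by (auto simp: nsets_def)
  then show ?thesis
    unfolding multicut_def using component_of_node_eq_iff[of _ V _ "E - \<delta>"] by blast
qed

text \<open>Without edges every node is isolated, and the two nodes of a terminal pair are distinct.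
  The resulting point of the dominant serves later as a base point.\<close>

lemma multicut_all_edges:
  assumes "S \<subseteq> nsets V 2"
  shows "multicut V E S E"
proof -
  have "s \<noteq> t" if "{s, t} \<in> S" for s t
    using that assms by (auto simp: nsets_def)
  then show ?thesis
    by (auto simp: multicut_iff[OF assms])
qed

text \<open>Distinct ends force at least one edge, so each node has a successor or, at the end, a
  predecessor on the path. This puts the path inside the support graph, whose nodes are the
  endpoints of its edges.\<close>

lemma successively_vertices_subset:
  assumes "successively (\<lambda>x y. {x, y} \<in> E) p" "p \<noteq> []" "hd p \<noteq> last p"
  shows "set p \<subseteq> \<Union>E"
proof
  fix x assume "x \<in> set p"
  then obtain i where i: "i < length p" "p ! i = x"
    by (auto simp: in_set_conv_nth)
  have len: "length p > 1"
    using assms(2,3) by (cases p rule: remdups_adj.cases) auto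
  show "x \<in> \<Union>E"
  proof (cases "Suc i < length p")
    case True
    then have "{p ! i, p ! Suc i} \<in> E"
      using assms(1) unfolding successively_conv_nth by blast
    with i show ?thesis by auto
  next
    case False
    with i len obtain j where "i = Suc j"
      by (cases i) auto
    with i have "{p ! j, p ! i} \<in> E"
      using assms(1) unfolding successively_conv_nth by blast
    with i show ?thesis by auto
  qed
qed

text \<open>A path joining a terminal pair after the change uses edges of \<open>T\<close> alone. By
  assumption it avoids \<open>e\<close>, so all its edges were already uncut by \<delta>, which is
  impossible.\<close>

lemma multicut_cut_nonsupport_restore_edge:
  assumes S: "S \<subseteq> nsets V 2" and \<delta>: "multicut V E S \<delta>" and "e \<in> T"
    and no_path: "\<not> (\<exists>s t p. {s, t} \<in> S \<and> is_path (\<Union>T) T s t p \<and> e \<in> path_edges p)"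
  shows "multicut V E S ((\<delta> \<union> (E - T)) - {e})" (is "multicut V E S ?\<delta>'")
  unfolding multicut_iff[OF S]
proof (intro conjI allI impI notI)
  show "?\<delta>' \<subseteq> E"
    using \<delta> by (auto simp: multicut_def)
  fix s t assume st: "{s, t} \<in> S" and walk: "(s, t) \<in> {(x, y). {x, y} \<in> E - ?\<delta>'}\<^sup>*"
  obtain p where p: "p \<noteq> []" "hd p = s" "last p = t" "distinct p"
      "successively (\<lambda>x y. {x, y} \<in> E - ?\<delta>') p"
    using rtrancl_imp_distinct_path[OF walk] by auto
  have "s \<noteq> t"
    using st S by (auto simp: nsets_def)
  have edges: "{p ! i, p ! Suc i} \<in> E - ?\<delta>'" if "Suc i < length p" for i
    using p(5) that unfolding successively_conv_nth by blast
  have "E - ?\<delta>' \<subseteq> T"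
    using \<open>e \<in> T\<close> by blast
  then have in_T: "successively (\<lambda>x y. {x, y} \<in> T) p"
    using edges unfolding successively_conv_nth by blast
  then have "set p \<subseteq> \<Union>T"
    using p \<open>s \<noteq> t\<close> by (intro successively_vertices_subset) auto
  with p in_T have "is_path (\<Union>T) T s t p"
    by (simp add: is_path_def)
  with no_path st have "e \<notin> path_edges p"
    by blast
  \<comment> \<open>Apart from \<open>e\<close>, every edge of \<open>E - ?\<delta>'\<close> belongs
    to \<open>E - \<delta>\<close>.\<close>
  then have "{p ! i, p ! Suc i} \<noteq> e" if "Suc i < length p" for i
    using that by (auto simp: path_edges_def)
  with edges have "successively (\<lambda>x y. (x, y) \<in> {(x, y). {x, y} \<in> E - \<delta>}) p"
    unfolding successively_conv_nth by blast
  then have "(s, t) \<in> {(x, y). {x, y} \<in> E - \<delta>}\<^sup>*"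
    using successively_imp_rtrancl p by blast
  with st \<delta> show False
    unfolding multicut_iff[OF S] by blast
qed

section \<open>The multicut dominant\<close>

lemma incidence_vector_in_edge_space: "F \<subseteq> E \<Longrightarrow> incidence_vector F \<in> edge_space E"
  by (auto simp: incidence_vector_def edge_space_def)

lemma subspace_edge_space: "subspace (edge_space E)"
  by (auto simp: subspace_def edge_space_def)

lemma multicut_polytope_bounds:
  fixes V :: "'v::finite set"
  shows "multicut_polytope V E S \<subseteq> edge_space E \<inter> {x. \<forall>e. 0 \<le> x $ e}"
  unfolding multicut_polytope_def
proof (rule hull_minimal)
  show "{incidence_vector \<delta> | \<delta>. multicut V E S \<delta>} \<subseteq> edge_space E \<inter> {x. \<forall>e. 0 \<le> x $ e}"
    by (auto simp: multicut_def incidence_vector_in_edge_space) (auto simp: incidence_vector_def)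
  have "convex {x :: real ^ 'v set. \<forall>e. 0 \<le> x $ e}"
    by (auto simp: convex_def)
  then show "convex (edge_space E \<inter> {x :: real ^ 'v set. \<forall>e. 0 \<le> x $ e})"
    using subspace_imp_convex[OF subspace_edge_space] by (intro convex_Int)
qed

lemma multicut_dominant_bounds:
  fixes V :: "'v::finite set"
  assumes "x \<in> multicut_dominant V E S"
  shows "x \<in> edge_space E" "0 \<le> x $ e"
proof -
  obtain y r where x: "x = y + r" "y \<in> multicut_polytope V E S"
      "r \<in> edge_space E" "\<forall>e\<in>E. 0 \<le> r $ e"
    using assms by (auto simp: multicut_dominant_def set_plus_def)
  then have y: "y \<in> edge_space E" "0 \<le> y $ e"
    using multicut_polytope_bounds by blast+
  show "x \<in> edge_space E"
    using x y by (auto intro: subspace_add subspace_edge_space)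
  have "0 \<le> r $ e"
    using x by (cases "e \<in> E") (auto simp: edge_space_def)
  with x y show "0 \<le> x $ e"
    by simp
qed

lemma incidence_vector_in_dominant:
  assumes "multicut V E S \<delta>"
  shows "incidence_vector \<delta> \<in> multicut_dominant V E S"
proof -
  have "incidence_vector \<delta> \<in> multicut_polytope V E S"
    unfolding multicut_polytope_def using assms by (auto intro: hull_inc)
  moreover have "(0 :: real ^ 'a set) \<in> {x \<in> edge_space E. \<forall>e\<in>E. 0 \<le> x $ e}"
    by (auto simp: edge_space_def)
  ultimately have "incidence_vector \<delta> + 0 \<in> multicut_dominant V E S"
    unfolding multicut_dominant_def by (rule set_plus_intro)
  then show ?thesis by simp
qed

lemma multicut_dominant_upward_closed:
  assumes "x \<in> multicut_dominant V E S" "r \<in> edge_space E" "\<forall>e\<in>E. 0 \<le> r $ e"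
  shows "x + r \<in> multicut_dominant V E S"
proof -
  obtain y q where x: "x = y + q" "y \<in> multicut_polytope V E S"
      "q \<in> edge_space E" "\<forall>e\<in>E. 0 \<le> q $ e"
    using assms by (auto simp: multicut_dominant_def set_plus_def)
  have "q + r \<in> {x \<in> edge_space E. \<forall>e\<in>E. 0 \<le> x $ e}"
    using x assms by (auto intro: subspace_add subspace_edge_space)
  with x(2) have "y + (q + r) \<in> multicut_dominant V E S"
    unfolding multicut_dominant_def by (rule set_plus_intro)
  with x show ?thesis by (simp add: add.assoc)
qed

text \<open>The dominant contains a point together with all its nonnegative translates in the edge
  space. Its dimension is therefore that of the edge space, which fixes the dimension of its
  facets.\<close>

lemma affine_hull_multicut_dominant:
  fixes V :: "'v::finite set"
  assumes "S \<subseteq> nsets V 2"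
  shows "affine hull (multicut_dominant V E S) = edge_space E" (is "affine hull ?P = _")
proof
  show "affine hull ?P \<subseteq> edge_space E"
    using multicut_dominant_bounds(1)
    by (intro hull_minimal subspace_imp_affine subspace_edge_space) blast
  show "edge_space E \<subseteq> affine hull ?P"
  proof
    fix y :: "real ^ 'v set" assume y: "y \<in> edge_space E"
    define z :: "real ^ 'v set" where "z = incidence_vector E"
    \<comment> \<open>\<open>u\<close> and \<open>w\<close> are the positive and negative parts of
      \<open>y - z\<close>, so \<open>y = z + u - w\<close>. This is the affine combination of
      \<open>z\<close>, \<open>z + u\<close>, \<open>z + w\<close> with coefficients 1, 1,
      -1.\<close>
    define u where "u = (\<chi> e. max 0 ((y - z) $ e))"
    define w where "w = (\<chi> e. max 0 (- (y - z) $ e))"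
    have z: "z \<in> ?P"
      unfolding z_def by (intro incidence_vector_in_dominant multicut_all_edges assms)
    have zE: "z \<in> edge_space E"
      by (simp add: z_def incidence_vector_in_edge_space)
    have "z + u \<in> ?P" "z + w \<in> ?P"
      using y zE by (auto intro!: multicut_dominant_upward_closed z
          simp: u_def w_def edge_space_def)
    with z have "1 *\<^sub>R z + 1 *\<^sub>R (z + u) + (-1) *\<^sub>R (z + w) \<in> affine hull ?P"
      by (intro mem_affine_3) (auto intro: hull_inc)
    moreover have "1 *\<^sub>R z + 1 *\<^sub>R (z + u) + (-1) *\<^sub>R (z + w) = y"
      by (auto simp: vec_eq_iff u_def w_def)
    ultimately show "y \<in> affine hull ?P" by simp
  qed
qed

section \<open>Coefficients of valid inequalities and facets in coordinate hyperplanes\<close>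

lemma axis_in_edge_space: "e \<in> E \<Longrightarrow> axis e c \<in> edge_space E"
  by (auto simp: edge_space_def axis_def)

text \<open>The dominant is unbounded in direction \<open>e\<close>; a negative coefficient would
  make \<open>a \<bullet> x\<close> arbitrarily small along that ray.\<close>

lemma valid_inequality_nonneg:
  fixes V :: "'v::finite set"
  assumes "S \<subseteq> nsets V 2" "e \<in> E"
    and valid: "\<And>x. x \<in> multicut_dominant V E S \<Longrightarrow> b \<le> a \<bullet> x"
  shows "0 \<le> a $ e"
proof (rule ccontr)
  assume neg: "\<not> 0 \<le> a $ e"
  let ?z = "incidence_vector E :: real ^ 'v set"
  \<comment> \<open>The step length is chosen so that the left-hand side drops to exactly
    \<open>b - 1\<close>.\<close>
  define c where "c = (a \<bullet> ?z - b + 1) / (- a $ e)"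
  have z: "?z \<in> multicut_dominant V E S"
    by (intro incidence_vector_in_dominant multicut_all_edges assms)
  then have "c \<ge> 0"
    using valid[OF z] neg unfolding c_def by (intro divide_nonneg_pos) auto
  then have "?z + axis e c \<in> multicut_dominant V E S"
    using assms by (intro multicut_dominant_upward_closed z axis_in_edge_space)
      (auto simp: axis_def)
  from valid[OF this] have "b \<le> a \<bullet> ?z + a $ e * c"
    by (simp add: inner_add_right inner_axis)
  also have "a $ e * c = - (a \<bullet> ?z - b + 1)"
    using neg by (simp add: c_def field_simps)
  finally show False by simp
qed

text \<open>The facet has codimension 1 in the edge space and lies in the proper subspace
  \<open>?H\<close>, so its affine hull is all of \<open>?H\<close>. The equation
  \<open>a \<bullet> x = b\<close> then holds throughout \<open>?H\<close> and can be tested at 0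
  and at unit vectors.\<close>

lemma facet_in_coordinate_hyperplane:
  fixes P :: "(real ^ ('v::finite set)) set"
  assumes hull: "affine hull P = edge_space E"
    and facet: "(P \<inter> {x. a \<bullet> x = b}) facet_of P"
    and "e \<in> E" and sub: "P \<inter> {x. a \<bullet> x = b} \<subseteq> {x. x $ e = 0}"
  shows "b = 0" "\<And>f. f \<in> E \<Longrightarrow> f \<noteq> e \<Longrightarrow> a $ f = 0"
proof -
  let ?F = "P \<inter> {x. a \<bullet> x = b}" and ?H = "edge_space E \<inter> {x :: real ^ 'v set. x $ e = 0}"
  have H: "subspace ?H"
    by (rule subspace_inter[OF subspace_edge_space]) (auto simp: subspace_def)
  have ne: "?F \<noteq> {}" and dim: "aff_dim ?F = aff_dim P - 1"
    using facet by (auto simp: facet_of_def)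
  have "?F \<subseteq> ?H"
    using sub hull hull_subset[of P affine] by blast
  then have FH: "affine hull ?F \<subseteq> ?H"
    using H by (intro hull_minimal subspace_imp_affine)
  \<comment> \<open>This unit vector shows that \<open>?H\<close> is a proper subspace, hence of
    smaller dimension.\<close>
  have "axis e 1 \<in> edge_space E - ?H"
    using \<open>e \<in> E\<close> by (auto simp: axis_in_edge_space)
  then have "?H \<noteq> edge_space E"
    by blast
  then have "aff_dim ?H < aff_dim (edge_space E :: (real ^ 'v set) set)"
    using affine_dim_equal[of ?H "edge_space E"] aff_dim_subset[of ?H "edge_space E"]
      subspace_0[OF H] subspace_imp_affine[OF H] subspace_imp_affine[OF subspace_edge_space[of E]]
    by (metis empty_iff inf_le1 order_le_less)
  also have "\<dots> = aff_dim P"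
    by (metis hull aff_dim_affine_hull)
  finally have "aff_dim ?H \<le> aff_dim ?F"
    using dim by simp
  moreover have "aff_dim ?F \<le> aff_dim ?H"
    using \<open>?F \<subseteq> ?H\<close> by (rule aff_dim_subset)
  ultimately have "affine hull ?F = ?H"
    using FH H ne by (intro affine_dim_equal) (auto simp: subspace_imp_affine)
  moreover have "affine hull ?F \<subseteq> {x. a \<bullet> x = b}"
    by (intro hull_minimal affine_hyperplane) auto
  ultimately have eq: "a \<bullet> x = b" if "x \<in> ?H" for x
    using that by blast
  show "b = 0"
    using eq[of 0] subspace_0[OF H] by simp
  show "a $ f = 0" if "f \<in> E" "f \<noteq> e" for f
  proof -
    have "axis f 1 \<in> ?H"
      using that axis_in_edge_space[of f E 1] by (simp add: axis_def)
    from eq[OF this] show ?thesis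
      using \<open>b = 0\<close> by (simp add: inner_axis)
  qed
qed

section \<open>Support edges and leaves\<close>

lemma support_edge_on_terminal_path:
  fixes V :: "'v::finite set" and E S :: "'v set set"
    and a :: "real ^ ('v set)" and b :: real
  assumes S: "S \<subseteq> nsets V 2"
    and aE: "a \<in> edge_space E"
    and facet: "facet_defining (multicut_dominant V E S) a b"
    and nontriv: "\<And>e'. e' \<in> E \<Longrightarrow>
           {x \<in> edge_space E. a \<bullet> x \<ge> b} \<noteq> {x \<in> edge_space E. x $ e' \<ge> 0}"
    and e: "e \<in> supp_edges E a"
  shows "\<exists>s t p. {s, t} \<in> S \<and>
            is_path (supp_nodes E a) (supp_edges E a) s t p \<and> e \<in> path_edges p"
proof (rule ccontr)
  let ?P = "multicut_dominant V E S" and ?T = "supp_edges E a"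
  assume no_path: "\<not> ?thesis"
  have eE: "e \<in> E"
    using e by (simp add: supp_edges_def)
  have valid: "b \<le> a \<bullet> x" if "x \<in> ?P" for x
    using facet that by (simp add: facet_defining_def)
  have nonneg: "0 \<le> a $ f" for f
    using valid_inequality_nonneg[OF S _ valid] aE by (cases "f \<in> E") (auto simp: edge_space_def)
  then have pos: "0 < a $ e"
    using e by (auto simp: supp_edges_def less_le)
  \<comment> \<open>The vector \<open>a\<close> with its coefficient at \<open>e\<close> set to 0;
    the aim is that \<open>c \<bullet> x \<ge> b\<close> is still valid.\<close>
  define c where "c = a - axis e (a $ e)"
  have c_nth: "c $ f = (if f = e then 0 else a $ f)" for f
    by (simp add: c_def axis_def)
  have "b \<le> c \<bullet> incidence_vector \<delta>" if \<delta>: "multicut V E S \<delta>" for \<delta>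
  proof -
    let ?\<delta>' = "(\<delta> \<union> (E - ?T)) - {e}"
    have "multicut V E S ?\<delta>'"
      using no_path by (intro multicut_cut_nonsupport_restore_edge S \<delta> e)
        (auto simp: supp_nodes_def)
    then have "b \<le> a \<bullet> incidence_vector ?\<delta>'"
      by (intro valid incidence_vector_in_dominant)
    \<comment> \<open>\<open>?\<delta>'\<close> and \<delta> can differ in edges of coefficient 0
      and in \<open>e\<close>; at \<open>e\<close> both products vanish, since
      \<open>?\<delta>'\<close> omits \<open>e\<close> and \<open>c\<close> is 0 there.\<close>
    also have "\<dots> = c \<bullet> incidence_vector \<delta>"
      unfolding inner_vec_def
      by (intro sum.cong) (auto simp: incidence_vector_def c_nth supp_edges_def)
    finally show ?thesis .
  qed
  then have "multicut_polytope V E S \<subseteq> {x. c \<bullet> x \<ge> b}"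
    unfolding multicut_polytope_def by (intro hull_minimal convex_halfspace_ge) auto
  \<comment> \<open>Validity passes from the polytope to the dominant because \<open>c\<close> is
    nonnegative on the added directions.\<close>
  moreover have "0 \<le> c \<bullet> r" if "r \<in> edge_space E" "\<forall>f\<in>E. 0 \<le> r $ f" for r
  proof -
    have "0 \<le> r $ f" for f
      using that by (cases "f \<in> E") (auto simp: edge_space_def)
    then show ?thesis
      unfolding inner_vec_def by (intro sum_nonneg) (auto simp: c_nth nonneg)
  qed
  ultimately have "b \<le> c \<bullet> x" if "x \<in> ?P" for x
    using that by (force simp: multicut_dominant_def set_plus_def inner_add_right)
  then have strong: "b + a $ e * x $ e \<le> a \<bullet> x" if "x \<in> ?P" for x
    using that by (fastforce simp: c_def inner_diff_left inner_axis' mult.commute)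
  \<comment> \<open>Equality leaves \<open>a $ e * x $ e \<le> 0\<close> with a positive coefficient
    and a nonnegative coordinate.\<close>
  have "x $ e = 0" if "x \<in> ?P" "a \<bullet> x = b" for x
    using strong[OF that(1)] that(2) pos multicut_dominant_bounds(2)[OF that(1), of e]
    by (smt (verit) mult_pos_pos)
  then have sub: "?P \<inter> {x. a \<bullet> x = b} \<subseteq> {x. x $ e = 0}"
    by blast
  have F: "(?P \<inter> {x. a \<bullet> x = b}) facet_of ?P"
    using facet by (simp add: facet_defining_def)
  note zero = facet_in_coordinate_hyperplane[OF affine_hull_multicut_dominant[OF S] F eE sub]
  \<comment> \<open>Coordinates outside \<open>E\<close> vanish by \<open>aE\<close>. As also
    \<open>b = 0\<close>, the inequality is a positive multiple of \<open>x $ e \<ge> 0\<close>,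
    which \<open>nontriv\<close> excludes.\<close>
  have "a = axis e (a $ e)"
    using zero(2) aE by (auto simp: vec_eq_iff axis_def edge_space_def)
  then have "a \<bullet> x = a $ e * x $ e" for x
    by (metis inner_axis' inner_real_def)
  then have "{x \<in> edge_space E. a \<bullet> x \<ge> b} = {x \<in> edge_space E. x $ e \<ge> 0}"
    using pos zero(1) by (simp add: zero_le_mult_iff)
  with nontriv[OF eE] show False ..
qed

text \<open>An inner node of a path meets two path edges, which are different because the nodes are
  distinct; a leaf meets just one edge.\<close>

lemma leaf_on_path_is_endpoint:
  assumes leaf: "leaf (\<Union>T) T v" and path: "is_path W T s t p"
    and "e \<in> path_edges p" "v \<in> e"
  shows "v = s \<or> v = t"
proof -
  have p: "distinct p" "hd p = s" "last p = t" "p \<noteq> []" "successively (\<lambda>x y. {x, y} \<in> T) p"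
    using path by (auto simp: is_path_def)
  have "v \<in> set p"
    using assms(3,4) by (auto simp: path_edges_def)
  then obtain i where i: "i < length p" "p ! i = v"
    by (auto simp: in_set_conv_nth)
  consider "i = 0" | "i = length p - 1" | j where "i = Suc j" "Suc i < length p"
    using i(1) by (cases i) (auto, linarith)
  then show ?thesis
  proof cases
    case 1
    with i p show ?thesis by (simp add: hd_conv_nth)
  next
    case 2
    with i p show ?thesis by (simp add: last_conv_nth)
  next
    case 3
    have "{p ! j, p ! i} \<in> {e \<in> T. v \<in> e}" "{p ! i, p ! Suc i} \<in> {e \<in> T. v \<in> e}"
      using 3 i p(5) by (auto simp: successively_conv_nth)
    moreover obtain d where "{e \<in> T. v \<in> e} = {d}"
      using leaf by (auto simp: leaf_def card_1_singleton_iff)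
    \<comment> \<open>Equal edges would force \<open>p ! j = p ! Suc i\<close>, against
      distinctness.\<close>
    ultimately have "{p ! j, p ! i} = {p ! i, p ! Suc i}"
      by auto
    with p(1) 3 show ?thesis
      by (auto simp: doubleton_eq_iff nth_eq_iff_index_eq)
  qed
qed

theorem theorem3p3:
  fixes V :: "'v::finite set" and E S :: "'v set set"
    and a :: "real ^ ('v set)" and b :: real
  assumes "simple_graph V E"
    and "S \<subseteq> nsets V 2"
    and "a \<in> edge_space E"
    and "facet_defining (multicut_dominant V E S) a b"
    and "\<And>e'. e' \<in> E \<Longrightarrow>
           {x \<in> edge_space E. a \<bullet> x \<ge> b} \<noteq> {x \<in> edge_space E. x $ e' \<ge> 0}"
  shows "(\<forall>e \<in> supp_edges E a. \<exists>s t p. {s, t} \<in> S \<and>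
            is_path (supp_nodes E a) (supp_edges E a) s t p \<and> e \<in> path_edges p) \<and>
         (\<forall>v. leaf (supp_nodes E a) (supp_edges E a) v \<longrightarrow> terminal S v)"
proof (intro conjI ballI allI impI)
  show on_path: "\<exists>s t p. {s, t} \<in> S \<and>
      is_path (supp_nodes E a) (supp_edges E a) s t p \<and> e \<in> path_edges p"
    if "e \<in> supp_edges E a" for e
    using support_edge_on_terminal_path[OF assms(2-5) that] .
  fix v assume leaf: "leaf (supp_nodes E a) (supp_edges E a) v"
  \<comment> \<open>A terminal path through an edge at the leaf must start or end at the leaf, and
    both ends of such a path are terminals.\<close>
  then obtain e where e: "e \<in> supp_edges E a" "v \<in> e"
    by (auto simp: leaf_def supp_nodes_def)
  from on_path[OF e(1)] obtain s t p where "{s, t} \<in> S"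
      and "is_path (supp_nodes E a) (supp_edges E a) s t p" "e \<in> path_edges p"
    by blast
  moreover from this have "v = s \<or> v = t"
    using leaf_on_path_is_endpoint[OF leaf[unfolded supp_nodes_def]] e(2) by blast
  ultimately show "terminal S v"
    by (auto simp: terminal_def insert_commute)
qed

end
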